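(* For every integer $k\ge 1$ and every integer $n\ge 0$, $$B_3(3^k n+3^k-1)=3^{2k}B_3(n).$$
   Context: A partition is a 3-core if none of its hook numbers is a multiple of 3 (the empty partition is a 3-core). For an integer $n\ge 0$, $B_3(n)$ denotes the number of partition triples of $n$ with 3-cores, i.e. ordered triples $(\lambda_1,\lambda_2,\lambda_3)$ of (possibly empty) partitions, each a 3-core, such that the sum of all the parts of $\lambda_1,\lambda_2,\lambda_3$ equals $n$; in particular $B_3(0)=1$. Equivalently (a standard fact recalled in the paper), $\sum_{n\ge 0}B_3(n)q^n=\dfrac{f_3^9}{f_1^3}$, where $f_k=\prod_{m=1}^{\infty}(1-q^{km})$. *)

theory Defs
  imports Main
begin

text \<open>A partition is the list of its (positive) parts in weakly decreasing order; the empty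
  partition is the empty list, and \<^term>\<open>sum_list p\<close> is the size of \<^term>\<open>p\<close>.\<close>

definition is_partition :: "nat list \<Rightarrow> bool" where
  "is_partition p \<longleftrightarrow> sorted_wrt (\<ge>) p \<and> 0 \<notin> set p"

text \<open>The cells of the Young diagram are the pairs \<^term>\<open>(i, j)\<close> with \<^prop>\<open>i < length p\<close> and
  \<^prop>\<open>j < p ! i\<close> (rows and columns are numbered from 0). The hook number of a cell is
  its arm length plus its leg length plus one.\<close>

definition arm :: "nat list \<Rightarrow> nat \<Rightarrow> nat \<Rightarrow> nat" where
  "arm p i j = card {j'. j < j' \<and> j' < p ! i}"

definition leg :: "nat list \<Rightarrow> nat \<Rightarrow> nat \<Rightarrow> nat" where
  "leg p i j = card {i'. i < i' \<and> i' < length p \<and> j < p ! i'}"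

definition hook :: "nat list \<Rightarrow> nat \<Rightarrow> nat \<Rightarrow> nat" where
  "hook p i j = arm p i j + leg p i j + 1"

definition is_core :: "nat \<Rightarrow> nat list \<Rightarrow> bool" where
  "is_core t p \<longleftrightarrow> is_partition p \<and> (\<forall>i<length p. \<forall>j<p ! i. \<not> t dvd hook p i j)"

definition core3_triples :: "nat \<Rightarrow> (nat list \<times> nat list \<times> nat list) set" where
  "core3_triples n = {(p, q, r). is_core 3 p \<and> is_core 3 q \<and> is_core 3 r \<and>
     sum_list p + sum_list q + sum_list r = n}"

definition B3 :: "nat \<Rightarrow> nat" where
  "B3 n = card (core3_triples n)"

lemma length_le_sum_list: "0 \<notin> set p \<Longrightarrow> length p \<le> sum_list (p :: nat list)"
  by (induction p) auto

lemma finite_core3_triples: "finite (core3_triples n)"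
proof -
  let ?L = "{p :: nat list. set p \<subseteq> {..n} \<and> length p \<le> n}"
  have fin: "finite ?L"
    by (rule finite_lists_length_le) simp
  have mem: "p \<in> ?L" if "is_core 3 p" "sum_list p \<le> n" for p
    using that length_le_sum_list[of p] member_le_sum_list[of _ p]
    by (fastforce simp: is_core_def is_partition_def)
  have "core3_triples n \<subseteq> ?L \<times> ?L \<times> ?L"
    using mem by (fastforce simp: core3_triples_def)
  then show ?thesis
    using fin by (meson finite_SigmaI finite_subset)
qed

lemma B3_0: "B3 0 = 1"
proof -
  have empty: "is_core 3 p \<and> sum_list p = 0 \<longleftrightarrow> p = []" for p
    using length_le_sum_list[of p] by (cases p) (auto simp: is_core_def is_partition_def)
  have "core3_triples 0 = {([], [], [])}"
    using empty by (auto simp: core3_triples_def)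
  then show ?thesis by (simp add: B3_def)
qed

end

theory Submission
  imports Defs
begin

text \<open>It suffices to prove \<open>B3 (3 * n + 2) = 9 * B3 n\<close> (lemma \<open>B3_triple\<close>), because
  \<open>n \<mapsto> 3 * n + 2\<close> sends \<open>3 ^ k * n + 3 ^ k - 1\<close> to the same expression with \<open>k + 1\<close>.

  The first half of the argument turns cores into lattice points. A 3-core is determined by the
  set of hook numbers of its first column, its beta set. This set is closed under subtracting 3
  and avoids 0, so it consists of the first \<open>a\<close> numbers congruent to 1 and the first \<open>b\<close> numbers
  congruent to 2 modulo 3. The size of the core is then \<open>Q a b = a\<^sup>2 - a * b + b\<^sup>2 + b\<close>. The same
  polynomial makes sense on all of the integer lattice. If \<open>\<omega>\<close> is a primitive cube root of unity
  and \<open>\<theta> = 1 + 2 * \<omega>\<close>, so that \<open>\<theta>\<^sup>2 = - 3\<close>, then \<open>3 * Q a b + 1\<close> is the norm of the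
  Eisenstein integer \<open>1 - \<theta> * (a + b * \<omega>)\<close>. Multiplication by \<open>\<omega>\<close> becomes the affine rotation
  \<open>(a, b) \<mapsto> (- b - 1, a - b - 1)\<close>. It preserves \<open>Q\<close>, has the quadrant of pairs of natural
  numbers as a fundamental domain, and adds 1 to \<open>a + b\<close> modulo 3. So each orbit meets each of
  the three classes of \<open>a + b\<close> modulo 3 exactly once, and every single class is in
  size-preserving bijection with the 3-cores (\<open>cores_eq_residue_class\<close>). Consequently the
  triples of lattice points in any three prescribed classes with total size \<open>n\<close> number \<open>B3 n\<close>.

  The second half is a discrete Fourier transform on triples \<open>(u\<^sub>1, u\<^sub>2, u\<^sub>3)\<close> of Eisenstein
  integers. Its matrix has entries \<open>\<omega> ^ (2 * i * j)\<close> with \<open>i\<close> and \<open>j\<close> in \<open>{0, 1, 2}\<close>, and it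
  multiplies the sum of the norms by 3. The total size \<open>n\<close> corresponds to the norm sum \<open>3 * (n + 1)\<close>, so the transform takes size
  \<open>n\<close> to size \<open>3 * n + 2\<close>. It maps the triples of size \<open>n\<close> that satisfy one linear condition on
  their classes bijectively to the triples of size \<open>3 * n + 2\<close> in the classes \<open>(0, 0, 0)\<close>
  (\<open>fourier_map_image\<close>). The former fall into nine prescriptions of classes, each contributing
  \<open>B3 n\<close>, and the latter number \<open>B3 (3 * n + 2)\<close>.\<close>

section \<open>Beta sets of partitions\<close>

text \<open>The hook numbers of the first column: the row \<open>h\<close> above \<open>t\<close> has arm length \<open>h - 1\<close> and leg
  length \<open>length t\<close> there. Prepending a row leaves the beta numbers of the lower rows
  unchanged, which is why inductions below peel off the largest part.\<close>

fun beta_set :: "nat list \<Rightarrow> nat set" where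
  "beta_set [] = {}"
| "beta_set (h # t) = insert (h + length t) (beta_set t)"

lemma is_partition_Nil: "is_partition []"
  by (simp add: is_partition_def)

lemma is_partition_Cons:
  "is_partition (h # t) \<longleftrightarrow> is_partition t \<and> 0 < h \<and> (\<forall>x\<in>set t. x \<le> h)"
  by (auto simp: is_partition_def)

lemma finite_beta_set: "finite (beta_set p)"
  by (induction p) auto

lemma beta_set_bounds:
  assumes "is_partition p" "\<forall>x\<in>set p. x \<le> h" "x \<in> beta_set p"
  shows "0 < x \<and> x < h + length p"
  using assms by (induction p arbitrary: x h) (fastforce simp: is_partition_Cons)+

lemma beta_set_less_Cons:
  assumes "is_partition (h # t)" "x \<in> beta_set t"
  shows "x < h + length t"
  using assms beta_set_bounds[of t h x] by (simp add: is_partition_Cons)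

lemma zero_notin_beta_set: "is_partition p \<Longrightarrow> 0 \<notin> beta_set p"
  using beta_set_bounds[of p "sum_list p" 0] member_le_sum_list[of _ p] by auto

lemma beta_set_Cons_fresh: "is_partition (h # t) \<Longrightarrow> h + length t \<notin> beta_set t"
  using beta_set_less_Cons by blast

lemma card_beta_set: "is_partition p \<Longrightarrow> card (beta_set p) = length p"
  by (induction p)
     (auto simp: finite_beta_set beta_set_Cons_fresh is_partition_Cons card_insert_if
           dest: beta_set_bounds)

lemma sum_beta_set:
  "is_partition p \<Longrightarrow> \<Sum>(beta_set p) = sum_list p + \<Sum>{..<length p}"
proof (induction p)
  case (Cons h t)
  then have "is_partition t" by (simp add: is_partition_Cons)
  with Cons show ?case
    by (simp add: finite_beta_set beta_set_Cons_fresh lessThan_Suc)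
qed simp

text \<open>The first row contributes the maximum of the beta set, and the remaining numbers determine
  the remaining rows.\<close>

lemma beta_set_inj:
  assumes "is_partition p" "is_partition q" "beta_set p = beta_set q"
  shows "p = q"
  using assms
proof (induction p arbitrary: q)
  case Nil
  then show ?case by (cases q) auto
next
  case (Cons h t)
  then obtain h' t' where q: "q = h' # t'" by (cases q) auto
  have parts: "is_partition (h # t)" "is_partition (h' # t')" "is_partition t" "is_partition t'"
    using Cons.prems q by (auto simp: is_partition_Cons)
  have eq: "insert (h + length t) (beta_set t) = insert (h' + length t') (beta_set t')"
    using Cons.prems q by simp
  have top: "h + length t = h' + length t'"
  proof (rule ccontr)
    assume "h + length t \<noteq> h' + length t'"
    then have "h + length t \<in> beta_set t'" "h' + length t' \<in> beta_set t"
      using eq by (metis insertE insertI1)+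
    then show False
      using beta_set_less_Cons parts by (meson less_asym)
  qed
  then have "beta_set t = beta_set t'"
    using eq beta_set_Cons_fresh[OF parts(1)] beta_set_Cons_fresh[OF parts(2)]
    by (metis insert_ident)
  then have "t = t'" using Cons.IH parts by blast
  with top q show ?case by simp
qed

text \<open>The inverse reads the rows off from the bottom: an element \<open>m\<close> above \<open>l\<close> smaller elements
  is a row of length \<open>m - l\<close>. Rows are positive because the \<open>l\<close> smaller elements lie strictly
  between 0 and \<open>m\<close>.\<close>

lemma beta_set_surj:
  assumes "finite X" "0 \<notin> X"
  shows "\<exists>p. is_partition p \<and> beta_set p = X"
  using assms
proof (induction rule: finite_linorder_max_induct)
  case empty
  then show ?case using is_partition_Nil by (intro exI[of _ "[]"]) simp
next
  case (insert m X)
  then obtain t where t: "is_partition t" "beta_set t = X" by auto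
  have "X \<subseteq> {1..<m}"
    using insert by (auto simp: Suc_le_eq intro: Nat.gr0I)
  then have "card X \<le> m - 1"
    using card_mono[of "{1..<m}" X] by simp
  then have len: "length t \<le> m - 1"
    using card_beta_set[OF t(1)] t(2) by simp
  have "0 < m" using insert by (auto intro: Nat.gr0I)
  have "x \<le> m - length t" if "x \<in> set t" for x
  proof (cases t)
    case (Cons h t')
    have "h + length t' < m" using insert.hyps t Cons by auto
    moreover have "x \<le> h" using that t(1) Cons by (auto simp: is_partition_Cons)
    ultimately show ?thesis using Cons by simp
  qed (use that in simp)
  then have "is_partition ((m - length t) # t)"
    using t len \<open>0 < m\<close> by (auto simp: is_partition_Cons)
  moreover have "beta_set ((m - length t) # t) = insert m X"
    using t len by simp
  ultimately show ?case by blast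
qed

section \<open>Cores and their beta sets\<close>

text \<open>The boundary of the Young diagram has one vertical step for each row and one horizontal step
  for each column. Numbering the steps from the lower left corner, the vertical ones are the beta
  numbers, and the horizontal step of column \<open>j\<close> has the number of columns to its left plus the
  number of rows that end before it. The bound \<open>h\<close> permits columns to the right of the
  diagram, as occur when a longer row is put on top.\<close>

lemma gaps_of_beta_set:
  assumes "is_partition t" "\<forall>x\<in>set t. x \<le> h"
  shows "(\<lambda>j. j + length (filter (\<lambda>x. x \<le> j) t)) ` {..<h} = {..<h + length t} - beta_set t"
  using assms
proof (induction t arbitrary: h)
  case (Cons g t)
  let ?c = "\<lambda>t j. j + length (filter (\<lambda>x. x \<le> j) t)"
  have t: "is_partition t" "\<forall>x\<in>set t. x \<le> g" "g \<le> h"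
    using Cons.prems by (auto simp: is_partition_Cons)
  have "{..<h} = {..<g} \<union> {g..<h}" using t by auto
  moreover have "?c (g # t) ` {..<g} = ?c t ` {..<g}"
    by (rule image_cong) auto
  moreover have "?c (g # t) ` {g..<h} = (\<lambda>j. j + (length t + 1)) ` {g..<h}"
  proof (rule image_cong)
    fix j assume "j \<in> {g..<h}"
    then have "filter (\<lambda>x. x \<le> j) (g # t) = g # t"
      using t(2) by (auto simp: filter_id_conv)
    then show "?c (g # t) j = j + (length t + 1)" by (simp only: list.size)
  qed simp
  moreover have "(\<lambda>j. j + (length t + 1)) ` {g..<h} = {g + length t + 1..<h + length t + 1}"
    by (simp only: image_add_atLeastLessThan' add.assoc)
  ultimately have "?c (g # t) ` {..<h} =
      ({..<g + length t} - beta_set t) \<union> {g + length t + 1..<h + length t + 1}"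
    using Cons.IH[OF t(1,2)] by (simp only: image_Un)
  also have "\<dots> = {..<h + length (g # t)} - beta_set (g # t)"
    using beta_set_less_Cons[OF Cons.prems(1)] t(3) by fastforce
  finally show ?case .
qed auto

lemma hook_Cons_Suc: "hook (h # t) (Suc i) j = hook t i j"
proof -
  have "{i'. Suc i < i' \<and> i' < length (h # t) \<and> j < (h # t) ! i'} =
        Suc ` {i'. i < i' \<and> i' < length t \<and> j < t ! i'}"
    (is "?L = ?R")
  proof (rule set_eqI)
    fix x show "x \<in> ?L \<longleftrightarrow> x \<in> ?R" by (cases x) auto
  qed
  then have "leg (h # t) (Suc i) j = leg t i j"
    unfolding leg_def by (simp add: card_image)
  then show ?thesis by (simp add: hook_def arm_def)
qed

lemma hook_Cons_0:
  assumes "j < h"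
  shows "hook (h # t) 0 j + (j + length (filter (\<lambda>x. x \<le> j) t)) = h + length t"
proof -
  have "{j'. j < j' \<and> j' < h} = {j<..<h}" by auto
  then have arm: "arm (h # t) 0 j = h - Suc j"
    by (simp add: arm_def)
  have "{i'. 0 < i' \<and> i' < length (h # t) \<and> j < (h # t) ! i'} =
        Suc ` {i'. i' < length t \<and> j < t ! i'}"
    (is "?L = ?R")
  proof (rule set_eqI)
    fix x show "x \<in> ?L \<longleftrightarrow> x \<in> ?R" by (cases x) auto
  qed
  then have "leg (h # t) 0 j = length (filter (\<lambda>x. j < x) t)"
    unfolding leg_def by (simp add: card_image length_filter_conv_card)
  moreover have "length (filter (\<lambda>x. x \<le> j) t) + length (filter (\<lambda>x. j < x) t) = length t"
    using sum_length_filter_compl[of "\<lambda>x. x \<le> j" t] by (simp add: not_le)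
  ultimately show ?thesis using arm assms by (simp add: hook_def)
qed

text \<open>A hook of the first row runs along the boundary from its vertical step \<open>h + length t\<close> down to
  an earlier horizontal step, that is, to a gap of the beta set.\<close>

lemma first_row_hooks:
  assumes "is_partition (h # t)"
  shows "hook (h # t) 0 ` {..<h} = (\<lambda>y. h + length t - y) ` ({..<h + length t} - beta_set t)"
proof -
  let ?c = "\<lambda>j. j + length (filter (\<lambda>x. x \<le> j) t)"
  have "hook (h # t) 0 ` {..<h} = (\<lambda>y. h + length t - y) ` ?c ` {..<h}"
    unfolding image_image
  proof (rule image_cong)
    fix j assume "j \<in> {..<h}"
    then show "hook (h # t) 0 j = h + length t - ?c j"
      using hook_Cons_0[of j h t] by simp
  qed simp
  also have "?c ` {..<h} = {..<h + length t} - beta_set t"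
    using assms by (intro gaps_of_beta_set) (auto simp: is_partition_Cons)
  finally show ?thesis .
qed

text \<open>Hook numbers are exactly the differences between a beta number and a smaller gap, so the
  absence of multiples of \<open>t\<close> says that moving down by a multiple of \<open>t\<close> never leaves the set.\<close>

lemma is_core_iff_beta_set:
  "is_core t p \<longleftrightarrow>
     is_partition p \<and> (\<forall>x\<in>beta_set p. \<forall>y<x. t dvd x - y \<longrightarrow> y \<in> beta_set p)"
proof (induction p)
  case (Cons h p)
  show ?case
  proof (cases "is_partition (h # p)")
    case True
    then have p: "is_partition p" by (simp add: is_partition_Cons)
    let ?x = "h + length p"
    have "is_core t (h # p) \<longleftrightarrow>
        (\<forall>j<h. \<not> t dvd hook (h # p) 0 j) \<and> (\<forall>i<length p. \<forall>j<p ! i. \<not> t dvd hook p i j)"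
      using True by (simp add: is_core_def All_less_Suc2 hook_Cons_Suc)
    also have "(\<forall>j<h. \<not> t dvd hook (h # p) 0 j) \<longleftrightarrow> (\<forall>d\<in>hook (h # p) 0 ` {..<h}. \<not> t dvd d)"
      by auto
    also have "\<dots> \<longleftrightarrow> (\<forall>y<?x. t dvd ?x - y \<longrightarrow> y \<in> beta_set p)"
      unfolding first_row_hooks[OF True] by auto
    also have "(\<forall>i<length p. \<forall>j<p ! i. \<not> t dvd hook p i j) \<longleftrightarrow> is_core t p"
      using p by (simp add: is_core_def)
    also note Cons.IH
    finally have "is_core t (h # p) \<longleftrightarrow>
        (\<forall>y<?x. t dvd ?x - y \<longrightarrow> y \<in> beta_set p) \<and>
        (\<forall>x\<in>beta_set p. \<forall>y<x. t dvd x - y \<longrightarrow> y \<in> beta_set p)"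
      using p by blast
    moreover have "y \<in> beta_set (h # p) \<longleftrightarrow> y \<in> beta_set p"
      if "x \<in> beta_set (h # p)" "y < x" for x y
      using that beta_set_less_Cons[OF True, of x] by auto
    ultimately show ?thesis
      using True by (simp add: Ball_def) blast
  qed (auto simp: is_core_def)
qed (auto simp: is_core_def is_partition_Nil)

section \<open>Three-cores as pairs of natural numbers\<close>

text \<open>The 3-abacus with \<open>a\<close> beads on runner 1 and \<open>b\<close> beads on runner 2, pushed to the bottom.\<close>

definition core_beta :: "nat \<times> nat \<Rightarrow> nat set" where
  "core_beta = (\<lambda>(a, b). (\<lambda>i. 3 * i + 1) ` {..<a} \<union> (\<lambda>i. 3 * i + 2) ` {..<b})"

lemma runner_div_mod:
  fixes i r :: nat
  assumes "r < 3"
  shows "(3 * i + r) div 3 = i" "(3 * i + r) mod 3 = r"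
  using assms by simp_all

lemma mem_core_beta:
  "x \<in> core_beta (a, b) \<longleftrightarrow> x mod 3 = 1 \<and> x div 3 < a \<or> x mod 3 = 2 \<and> x div 3 < b"
proof -
  have "x \<in> (\<lambda>i. 3 * i + r) ` {..<m} \<longleftrightarrow> x mod 3 = r \<and> x div 3 < m" if "r < 3" for r m
  proof
    assume "x \<in> (\<lambda>i. 3 * i + r) ` {..<m}"
    then show "x mod 3 = r \<and> x div 3 < m"
      using runner_div_mod[OF that] by auto
  next
    assume "x mod 3 = r \<and> x div 3 < m"
    moreover have "x = 3 * (x div 3) + x mod 3" by simp
    ultimately show "x \<in> (\<lambda>i. 3 * i + r) ` {..<m}" by (metis imageI lessThan_iff)
  qed
  from this[of 1 a] this[of 2 b] show ?thesis
    unfolding core_beta_def prod.case Un_iff by linarith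
qed

lemma finite_initial_segment:
  fixes I :: "nat set"
  assumes "finite I" "\<And>i j. i \<in> I \<Longrightarrow> j < i \<Longrightarrow> j \<in> I"
  shows "\<exists>a. I = {..<a}"
proof (cases "I = {}")
  case False
  have "I = {..<Suc (Max I)}"
  proof (intro set_eqI iffI)
    fix i assume "i \<in> {..<Suc (Max I)}"
    then show "i \<in> I"
      using assms(2)[of "Max I" i] Max_in[OF assms(1) False] by (auto simp: less_Suc_eq)
  qed (use assms(1) in \<open>auto simp: less_Suc_eq_le\<close>)
  then show ?thesis ..
qed auto

text \<open>Each runner of a set closed under subtracting multiples of 3 is an initial segment; the
  runner of 0 is empty, as any element of it would bring 0 into the set.\<close>

lemma core_beta_surj:
  assumes "finite X" "0 \<notin> X" and closed: "\<forall>x\<in>X. \<forall>y<x. 3 dvd x - y \<longrightarrow> y \<in> X"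
  shows "\<exists>c. X = core_beta c"
proof -
  have runner: "\<exists>a. {i. 3 * i + r \<in> X} = {..<a}" for r
  proof (rule finite_initial_segment)
    have "inj (\<lambda>i::nat. 3 * i + r)" by (simp add: inj_def)
    then show "finite {i. 3 * i + r \<in> X}"
      using finite_vimageI[OF assms(1)] by (simp add: vimage_def)
  next
    fix i j assume "i \<in> {i. 3 * i + r \<in> X}" "j < i"
    moreover have "(3 * i + r) - (3 * j + r) = 3 * (i - j)" by simp
    ultimately show "j \<in> {i. 3 * i + r \<in> X}"
      using closed[rule_format, of "3 * i + r" "3 * j + r"] by simp
  qed
  obtain a b where ab: "{i. 3 * i + 1 \<in> X} = {..<a}" "{i. 3 * i + 2 \<in> X} = {..<b}"
    using runner by meson
  have "x \<in> X \<longleftrightarrow> x \<in> core_beta (a, b)" for x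
  proof -
    have x: "x = 3 * (x div 3) + x mod 3" by simp
    consider "x mod 3 = 0" | "x mod 3 = 1" | "x mod 3 = 2" by linarith
    then show ?thesis
    proof cases
      case 1
      then have "x \<notin> X"
        using assms(2) closed[rule_format, of x 0] by (cases "x = 0") auto
      then show ?thesis using 1 by (simp add: mem_core_beta)
    next
      case 2
      with x have "x \<in> X \<longleftrightarrow> x div 3 \<in> {i. 3 * i + 1 \<in> X}" by (metis mem_Collect_eq)
      then show ?thesis using 2 unfolding ab by (simp add: mem_core_beta)
    next
      case 3
      with x have "x \<in> X \<longleftrightarrow> x div 3 \<in> {i. 3 * i + 2 \<in> X}" by (metis mem_Collect_eq)
      then show ?thesis using 3 unfolding ab by (simp add: mem_core_beta)
    qed
  qed
  then show ?thesis by blast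
qed

lemma core_beta_closed:
  assumes "x \<in> core_beta c" "y < x" "3 dvd x - y"
  shows "y \<in> core_beta c"
proof -
  have "y mod 3 = x mod 3" "y div 3 \<le> x div 3"
    using assms(2,3) by (simp_all add: mod_eq_dvd_iff_nat[symmetric] div_le_mono)
  then show ?thesis using assms(1) by (cases c) (auto simp: mem_core_beta)
qed

lemma inj_core_beta: "inj core_beta"
proof (rule injI)
  fix c d assume "core_beta c = core_beta d"
  moreover obtain a b a' b' where cd: "c = (a, b)" "d = (a', b')" by fastforce
  ultimately have eq: "x \<in> core_beta (a, b) \<longleftrightarrow> x \<in> core_beta (a', b')" for x by simp
  have "i < a \<longleftrightarrow> i < a'" for i
    using eq[of "3 * i + 1"] runner_div_mod[of 1 i] by (simp only: mem_core_beta) simp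
  moreover have "i < b \<longleftrightarrow> i < b'" for i
    using eq[of "3 * i + 2"] runner_div_mod[of 2 i] by (simp only: mem_core_beta) simp
  ultimately show "c = d" using cd by (metis nat_neq_iff)
qed

text \<open>Up to the factor 3 and the constant 1, this is the norm of the Eisenstein integer
  \<open>1 - \<theta> * (a + b * \<omega>)\<close>, where \<open>\<theta> = 1 + 2 * \<omega>\<close>.\<close>

definition size_form :: "int \<times> int \<Rightarrow> int" where
  "size_form = (\<lambda>(a, b). a\<^sup>2 - a * b + b\<^sup>2 + b)"

text \<open>Summing the beta set counts the size plus \<open>0 + 1 + \<dots> + (l - 1)\<close>, where \<open>l = a + b\<close> is the
  number of rows, and the beads of each runner form an arithmetic progression.\<close>

lemma size_of_core_beta:
  assumes "is_partition p" "beta_set p = core_beta (a, b)"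
  shows "int (sum_list p) = size_form (int a, int b)"
proof -
  let ?A = "(\<lambda>i. 3 * i + 1) ` {..<a}" and ?B = "(\<lambda>i. 3 * i + 2) ` {..<b} :: nat set"
  have disj: "?A \<inter> ?B = {}" by (auto, presburger)
  have inj: "inj_on (\<lambda>i::nat. 3 * i + r) S" for r S by (simp add: inj_on_def)
  have sumA: "2 * int (\<Sum>i<a. 3 * i + 1) = 3 * (int a)\<^sup>2 - int a"
    by (induction a) (auto simp: power2_eq_square algebra_simps)
  have sumB: "2 * int (\<Sum>i<b. 3 * i + 2) = 3 * (int b)\<^sup>2 + int b"
    by (induction b) (auto simp: power2_eq_square algebra_simps)
  have gauss: "2 * int (\<Sum>{..<m}) = (int m)\<^sup>2 - int m" for m :: nat
    by (induction m) (auto simp: power2_eq_square algebra_simps)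
  have "card (core_beta (a, b)) = card ?A + card ?B"
    unfolding core_beta_def prod.case by (rule card_Un_disjoint) (use disj in simp_all)
  then have "card (core_beta (a, b)) = a + b"
    by (simp only: card_image[OF inj] card_lessThan)
  then have len: "length p = a + b"
    using card_beta_set assms by metis
  have "\<Sum>(core_beta (a, b)) = \<Sum>?A + \<Sum>?B"
    unfolding core_beta_def prod.case by (rule sum.union_disjoint) (use disj in simp_all)
  then have "\<Sum>(core_beta (a, b)) = (\<Sum>i<a. 3 * i + 1) + (\<Sum>i<b. 3 * i + 2)"
    by (simp only: sum.reindex[OF inj] o_def)
  then have "int (sum_list p) + int (\<Sum>{..<a + b}) =
      int (\<Sum>i<a. 3 * i + 1) + int (\<Sum>i<b. 3 * i + 2)"
    using sum_beta_set[OF assms(1)] assms(2) len by (metis of_nat_add)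
  then show ?thesis
    using sumA sumB gauss[of "a + b"]
    by (simp add: size_form_def power2_eq_square algebra_simps)
qed

definition core_of :: "nat \<times> nat \<Rightarrow> nat list" where
  "core_of c = (THE p. is_partition p \<and> beta_set p = core_beta c)"

lemma core_of_props: "is_partition (core_of c)" "beta_set (core_of c) = core_beta c"
proof -
  have "finite (core_beta c)" "0 \<notin> core_beta c"
    by (cases c, auto simp: core_beta_def)+
  then have "\<exists>!p. is_partition p \<and> beta_set p = core_beta c"
    using beta_set_surj beta_set_inj by metis
  from theI'[OF this] show "is_partition (core_of c)" "beta_set (core_of c) = core_beta c"
    unfolding core_of_def by auto
qed

lemma bij_core_of: "bij_betw core_of UNIV {p. is_core 3 p}"
  unfolding bij_betw_def
proof
  show "inj core_of"
    using inj_core_beta core_of_props(2) by (metis injD injI)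
  have "is_core 3 (core_of c)" for c
    using core_beta_closed by (simp add: is_core_iff_beta_set core_of_props)
  moreover have "p \<in> range core_of" if "is_core 3 p" for p
  proof -
    have p: "is_partition p" "\<forall>x\<in>beta_set p. \<forall>y<x. 3 dvd x - y \<longrightarrow> y \<in> beta_set p"
      using that by (auto simp: is_core_iff_beta_set)
    then obtain c where "beta_set p = core_beta c"
      using core_beta_surj[OF finite_beta_set zero_notin_beta_set] by blast
    then have "p = core_of c"
      using beta_set_inj p core_of_props by metis
    then show ?thesis by simp
  qed
  ultimately show "range core_of = {p. is_core 3 p}" by auto
qed

lemma sum_list_core_of: "int (sum_list (core_of (a, b))) = size_form (int a, int b)"
  by (rule size_of_core_beta[OF core_of_props])

section \<open>Three-cores as a residue class of lattice points\<close>

text \<open>Writing the lattice point as \<open>z = a + b * \<omega>\<close>, this is \<open>z\<close> modulo \<open>\<theta>\<close>, because \<open>\<omega>\<close> is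
  congruent to 1. Equivalently it decides which of \<open>1\<close>, \<open>\<omega>\<close> and \<open>\<omega>\<^sup>2\<close> the number
  \<open>1 - \<theta> * z\<close> is congruent to modulo 3.\<close>

definition residue_class :: "int \<times> int \<Rightarrow> int" where
  "residue_class = (\<lambda>(a, b). (a + b) mod 3)"

text \<open>The three branches are the powers of the affine rotation \<open>(a, b) \<mapsto> (- b - 1, a - b - 1)\<close>,
  which is multiplication of \<open>1 - \<theta> * (a + b * \<omega>)\<close> by \<open>\<omega>\<close>. Each application raises the
  residue class by 1, so \<open>k\<close> is the number of applications that lead to class \<open>j\<close>.\<close>

definition rotate_into :: "int \<Rightarrow> nat \<times> nat \<Rightarrow> int \<times> int" where
  "rotate_into j = (\<lambda>(a, b).
     let a = int a; b = int b; k = (j - a - b) mod 3 in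
     if k = 0 then (a, b) else if k = 1 then (- b - 1, a - b - 1) else (b - a, - a - 1))"

lemma size_form_rotate_into:
  "size_form (rotate_into j (a, b)) = size_form (int a, int b)"
  by (auto simp: rotate_into_def size_form_def Let_def power2_eq_square algebra_simps)

lemma rotate_into_cases:
  shows "(j - int a - int b) mod 3 = 0 \<Longrightarrow> rotate_into j (a, b) = (int a, int b)"
    and "(j - int a - int b) mod 3 = 1 \<Longrightarrow>
      rotate_into j (a, b) = (- int b - 1, int a - int b - 1)"
    and "(j - int a - int b) mod 3 = 2 \<Longrightarrow>
      rotate_into j (a, b) = (int b - int a, - int a - 1)"
  by (simp_all only: rotate_into_def Let_def prod.case) simp_all

lemma residue_class_rotate_into:
  assumes "j \<in> {0, 1, 2}"
  shows "residue_class (rotate_into j c) = j"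
proof -
  obtain a b where c: "c = (a, b)" by fastforce
  define q where "q = (j - int a - int b) div 3"
  have q: "j - int a - int b = 3 * q + (j - int a - int b) mod 3"
    unfolding q_def by simp
  have shift: "(j + 3 * m) mod 3 = j" for m using assms by auto
  consider "(j - int a - int b) mod 3 = 0" | "(j - int a - int b) mod 3 = 1"
    | "(j - int a - int b) mod 3 = 2"
    using pos_mod_bound[of 3 "j - int a - int b"] pos_mod_sign[of 3 "j - int a - int b"]
    by linarith
  then show ?thesis
  proof cases
    case 1
    then have "j = int a + int b + 0 + 3 * q" using q by linarith
    then have "int a + int b = j + 3 * (- q)" by (simp add: algebra_simps)
    then have "(int a + int b) mod 3 = j" using shift by metis
    then show ?thesis
      unfolding c rotate_into_cases(1)[OF 1] residue_class_def prod.case .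
  next
    case 2
    then have "j = int a + int b + 1 + 3 * q" using q by linarith
    then have "(- int b - 1) + (int a - int b - 1) = j + 3 * (- q - int b - 1)"
      by (simp add: algebra_simps)
    then have "((- int b - 1) + (int a - int b - 1)) mod 3 = j" using shift by metis
    then show ?thesis
      unfolding c rotate_into_cases(2)[OF 2] residue_class_def prod.case .
  next
    case 3
    then have "j = int a + int b + 2 + 3 * q" using q by linarith
    then have "(int b - int a) + (- int a - 1) = j + 3 * (- q - int a - 1)"
      by (simp add: algebra_simps)
    then have "((int b - int a) + (- int a - 1)) mod 3 = j" using shift by metis
    then show ?thesis
      unfolding c rotate_into_cases(3)[OF 3] residue_class_def prod.case .
  qed
qed

text \<open>Points from different branches differ because the images of the quadrant under the three
  powers of the rotation are disjoint.\<close>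

lemma inj_rotate_into: "inj (rotate_into j)"
proof (rule injI)
  fix c d assume "rotate_into j c = rotate_into j d"
  then show "c = d"
    by (cases c; cases d) (auto simp: rotate_into_def Let_def split: if_splits)
qed

text \<open>The three cones in the case distinction are the images of the quadrant under the powers of
  the rotation. They cover the plane, and in a given class only the power \<open>k\<close> prescribed by
  \<^const>\<open>rotate_into\<close> can apply.\<close>

lemma rotate_into_surj:
  assumes "residue_class v = j"
  shows "v \<in> range (rotate_into j)"
proof -
  obtain x y where v: "v = (x, y)" by fastforce
  define q where "q = (x + y) div 3"
  have j: "j = x + y - 3 * q"
    using assms by (simp add: v residue_class_def q_def minus_mult_div_eq_mod)
  consider "0 \<le> x" "0 \<le> y" | "x < 0" "x \<le> y" | "y < 0" "y < x" by linarith
  then show ?thesis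
  proof cases
    case 1
    define a b where "a = nat x" and "b = nat y"
    then have ab: "int a = x" "int b = y" using 1 by simp_all
    have "j - int a - int b = 0 + 3 * (- q)"
      by (simp add: j ab algebra_simps)
    then have "(j - int a - int b) mod 3 = 0"
      by (simp only: mod_mult_self2) simp
    then have "rotate_into j (a, b) = v"
      using rotate_into_cases(1)[of j a b] ab v by simp
    then show ?thesis by (metis rangeI)
  next
    case 2
    define a b where "a = nat (y - x)" and "b = nat (- x - 1)"
    then have ab: "int a = y - x" "int b = - x - 1" using 2 by simp_all
    have "j - int a - int b = 1 + 3 * (x - q)"
      by (simp add: j ab algebra_simps)
    then have "(j - int a - int b) mod 3 = 1"
      by (simp only: mod_mult_self2) simp
    then have "rotate_into j (a, b) = v"
      using rotate_into_cases(2)[of j a b] ab v by simp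
    then show ?thesis by (metis rangeI)
  next
    case 3
    define a b where "a = nat (- y - 1)" and "b = nat (x - y - 1)"
    then have ab: "int a = - y - 1" "int b = x - y - 1" using 3 by simp_all
    have "j - int a - int b = 2 + 3 * (y - q)"
      by (simp add: j ab algebra_simps)
    then have "(j - int a - int b) mod 3 = 2"
      by (simp only: mod_mult_self2) simp
    then have "rotate_into j (a, b) = v"
      using rotate_into_cases(3)[of j a b] ab v by simp
    then show ?thesis by (metis rangeI)
  qed
qed

lemma cores_eq_residue_class:
  assumes "j \<in> {0, 1, 2}"
  shows "\<exists>f. bij_betw f {v. residue_class v = j} {p. is_core 3 p} \<and>
    (\<forall>v. residue_class v = j \<longrightarrow> int (sum_list (f v)) = size_form v)"
proof -
  have range: "range (rotate_into j) = {v. residue_class v = j}"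
    using residue_class_rotate_into[OF assms] rotate_into_surj by blast
  then have bij: "bij_betw (rotate_into j) UNIV {v. residue_class v = j}"
    using inj_rotate_into by (simp add: bij_betw_def)
  let ?f = "core_of \<circ> inv (rotate_into j)"
  have "bij_betw ?f {v. residue_class v = j} {p. is_core 3 p}"
    using bij_betw_trans[OF bij_betw_inv_into[OF bij] bij_core_of] .
  moreover have "int (sum_list (?f v)) = size_form v" if *: "residue_class v = j" for v
  proof -
    obtain a b where v: "v = rotate_into j (a, b)"
      using rotate_into_surj[OF *] by fastforce
    show ?thesis
      by (simp add: v inj_rotate_into sum_list_core_of size_form_rotate_into)
  qed
  ultimately show ?thesis by blast
qed

definition class_triples ::
  "int \<Rightarrow> int \<Rightarrow> int \<Rightarrow> nat \<Rightarrow> ((int \<times> int) \<times> (int \<times> int) \<times> (int \<times> int)) set" where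
  "class_triples i j k n = {(u, v, w). residue_class u = i \<and> residue_class v = j \<and>
     residue_class w = k \<and> size_form u + size_form v + size_form w = int n}"

text \<open>The count does not depend on the classes \<open>i\<close>, \<open>j\<close>, \<open>k\<close>: this independence is what produces
  the factor 9 below.\<close>

lemma class_triples_eq_core3_triples:
  assumes "i \<in> {0, 1, 2}" "j \<in> {0, 1, 2}" "k \<in> {0, 1, 2}"
  shows "finite (class_triples i j k n)" "card (class_triples i j k n) = B3 n"
proof -
  obtain f where f: "bij_betw f {v. residue_class v = i} {p. is_core 3 p}"
      "\<And>v. residue_class v = i \<Longrightarrow> int (sum_list (f v)) = size_form v"
    using cores_eq_residue_class[OF assms(1)] by blast
  obtain g where g: "bij_betw g {v. residue_class v = j} {p. is_core 3 p}"
      "\<And>v. residue_class v = j \<Longrightarrow> int (sum_list (g v)) = size_form v"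
    using cores_eq_residue_class[OF assms(2)] by blast
  obtain h where h: "bij_betw h {v. residue_class v = k} {p. is_core 3 p}"
      "\<And>v. residue_class v = k \<Longrightarrow> int (sum_list (h v)) = size_form v"
    using cores_eq_residue_class[OF assms(3)] by blast
  let ?F = "map_prod f (map_prod g h)"
  let ?V = "{v. residue_class v = i} \<times> {v. residue_class v = j} \<times> {v. residue_class v = k}"
  let ?C = "{p. is_core 3 p}"
  have bij: "bij_betw ?F ?V (?C \<times> ?C \<times> ?C)"
    by (intro bij_betw_map_prod f(1) g(1) h(1))
  have mem: "x \<in> class_triples i j k n \<longleftrightarrow> ?F x \<in> core3_triples n" if "x \<in> ?V" for x
  proof -
    obtain u v w where x: "x = (u, v, w)" by (rule prod_cases3)
    have cls: "residue_class u = i" "residue_class v = j" "residue_class w = k"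
      using that x by simp_all
    then have cores: "is_core 3 (f u)" "is_core 3 (g v)" "is_core 3 (h w)"
      using bij_betw_apply[OF f(1), of u] bij_betw_apply[OF g(1), of v]
        bij_betw_apply[OF h(1), of w] by simp_all
    have "size_form u + size_form v + size_form w =
        int (sum_list (f u) + sum_list (g v) + sum_list (h w))"
      using f(2) g(2) h(2) cls by simp
    then show ?thesis
      unfolding x class_triples_def core3_triples_def map_prod_simp
      using cls cores by (simp only: mem_Collect_eq prod.case of_nat_eq_iff simp_thms)
  qed
  have sub: "class_triples i j k n \<subseteq> ?V"
    by (auto simp: class_triples_def)
  have "?F ` class_triples i j k n = core3_triples n"
  proof
    show "?F ` class_triples i j k n \<subseteq> core3_triples n"
      using mem sub by (meson image_subsetI subsetD)
    show "core3_triples n \<subseteq> ?F ` class_triples i j k n"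
    proof
      fix p assume p: "p \<in> core3_triples n"
      then have "p \<in> ?C \<times> ?C \<times> ?C" by (auto simp: core3_triples_def)
      then have "p \<in> ?F ` ?V" using bij by (simp only: bij_betw_def)
      then obtain x where x: "x \<in> ?V" "p = ?F x" by (rule imageE)
      have "x \<in> class_triples i j k n"
        using mem[OF x(1)] p unfolding x(2) by blast
      then show "p \<in> ?F ` class_triples i j k n" using x(2) by (rule rev_image_eqI)
    qed
  qed
  moreover have "inj_on ?F (class_triples i j k n)"
    using bij_betw_imp_inj_on[OF bij] sub by (rule inj_on_subset)
  ultimately have "bij_betw ?F (class_triples i j k n) (core3_triples n)"
    by (simp only: bij_betw_def)
  then show "finite (class_triples i j k n)" "card (class_triples i j k n) = B3 n"
    using bij_betw_finite[of ?F] bij_betw_same_card[of ?F] finite_core3_triples[of n]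
    by (auto simp: B3_def)
qed

section \<open>The discrete Fourier transform on triples of lattice points\<close>

text \<open>Put \<open>y\<^sub>i = a\<^sub>i + b\<^sub>i * \<omega>\<close> and represent the triple by \<open>x\<^sub>1 = - (1 - \<theta> * y\<^sub>1)\<close>,
  \<open>x\<^sub>2 = 1 - \<theta> * y\<^sub>2\<close> and \<open>x\<^sub>3 = 1 - \<theta> * y\<^sub>3\<close>. The result \<open>z\<close> is given by
  \<open>1 - \<theta> * z\<^sub>1 = x\<^sub>1 + x\<^sub>2 + x\<^sub>3\<close>, \<open>1 - \<theta> * z\<^sub>2 = x\<^sub>1 + \<omega>\<^sup>2 * x\<^sub>2 + \<omega> * x\<^sub>3\<close> and
  \<open>1 - \<theta> * z\<^sub>3 = x\<^sub>1 + \<omega> * x\<^sub>2 + \<omega>\<^sup>2 * x\<^sub>3\<close>, written out in coordinates. The sign of \<open>x\<^sub>1\<close>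
  makes the right-hand sides congruent to 1 modulo \<open>\<theta>\<close>, so that the \<open>z\<^sub>i\<close> are again integral.\<close>

fun fourier_map ::
  "(int \<times> int) \<times> (int \<times> int) \<times> (int \<times> int) \<Rightarrow> (int \<times> int) \<times> (int \<times> int) \<times> (int \<times> int)" where
  "fourier_map ((a1, b1), (a2, b2), (a3, b3)) =
     ((a2 + a3 - a1, b2 + b3 - b1),
      (b2 - a2 - b3 - a1 - 1, a3 - a2 - b3 - b1 - 2),
      (b3 - b2 - a3 - a1 - 1, a2 - b2 - a3 - b1 - 2))"

text \<open>The three output points of \<^const>\<open>fourier_map\<close> all have the same residue class, namely that
  of \<open>v\<close> plus that of \<open>w\<close> minus that of \<open>u\<close>. The condition says that this class is 0.\<close>

definition balanced_triples :: "nat \<Rightarrow> ((int \<times> int) \<times> (int \<times> int) \<times> (int \<times> int)) set" where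
  "balanced_triples n = {(u, v, w).
     residue_class u = (residue_class v + residue_class w) mod 3 \<and>
     size_form u + size_form v + size_form w = int n}"

lemma mem_balanced_triples:
  "((a1, b1), (a2, b2), (a3, b3)) \<in> balanced_triples n \<longleftrightarrow>
     3 dvd a2 + b2 + a3 + b3 - a1 - b1 \<and>
     size_form (a1, b1) + size_form (a2, b2) + size_form (a3, b3) = int n"
proof -
  have "(a1 + b1) mod 3 = ((a2 + b2) mod 3 + (a3 + b3) mod 3) mod 3 \<longleftrightarrow>
     3 dvd (a2 + b2 + (a3 + b3)) - (a1 + b1)"
    unfolding mod_add_eq mod_eq_dvd_iff by (rule dvd_diff_commute)
  moreover have "(a2 + b2 + (a3 + b3)) - (a1 + b1) = a2 + b2 + a3 + b3 - a1 - b1" by simp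
  ultimately show ?thesis
    unfolding balanced_triples_def residue_class_def mem_Collect_eq prod.case by simp
qed

lemma residue_class_range: "residue_class v \<in> {0, 1, 2}"
  by (cases v) (auto simp: residue_class_def)

text \<open>The classes of the last two points are free and determine that of the first.\<close>

lemma card_balanced_triples: "card (balanced_triples n) = 9 * B3 n"
proof -
  let ?I = "{0, 1, 2 :: int} \<times> {0, 1, 2 :: int}"
  let ?F = "\<lambda>(j, k). class_triples ((j + k) mod 3) j k n"
  have F: "finite (?F x) \<and> card (?F x) = B3 n" if "x \<in> ?I" for x
  proof -
    obtain j k where x: "x = (j, k)" by (rule prod.exhaust)
    have "(j + k) mod 3 \<in> {0, 1, 2}" "j \<in> {0, 1, 2}" "k \<in> {0, 1, 2}"
      using that residue_class_range[of "(j, k)"]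
      unfolding x mem_Sigma_iff residue_class_def prod.case by simp_all
    then show ?thesis
      unfolding x prod.case by (intro conjI class_triples_eq_core3_triples)
  qed
  have disjoint: "?F x \<inter> ?F y = {}" if "x \<noteq> y" for x y
  proof -
    obtain j k j' k' where "x = (j, k)" "y = (j', k')"
      by (meson prod.exhaust)
    then show ?thesis using that by (auto simp: class_triples_def)
  qed
  have "balanced_triples n = (\<Union>x\<in>?I. ?F x)"
  proof (intro set_eqI iffI)
    fix t assume t: "t \<in> balanced_triples n"
    obtain u v w where uvw: "t = (u, v, w)" by (rule prod_cases3)
    have "(residue_class v, residue_class w) \<in> ?I"
      using residue_class_range by blast
    moreover have "t \<in> ?F (residue_class v, residue_class w)"
      using t by (simp add: uvw balanced_triples_def class_triples_def)
    ultimately show "t \<in> (\<Union>x\<in>?I. ?F x)" by (rule UN_I)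
  next
    fix t assume "t \<in> (\<Union>x\<in>?I. ?F x)"
    then obtain j k where "t \<in> class_triples ((j + k) mod 3) j k n" by blast
    then show "t \<in> balanced_triples n"
      by (auto simp: class_triples_def balanced_triples_def)
  qed
  also have "card (\<Union>x\<in>?I. ?F x) = (\<Sum>x\<in>?I. card (?F x))"
  proof (rule card_UN_disjoint)
    show "\<forall>x\<in>?I. finite (?F x)" using F by blast
    show "\<forall>x\<in>?I. \<forall>y\<in>?I. x \<noteq> y \<longrightarrow> ?F x \<inter> ?F y = {}" using disjoint by blast
  qed simp
  also have "\<dots> = (\<Sum>x\<in>?I. B3 n)"
    using F by (intro sum.cong refl) blast
  also have "\<dots> = card ?I * B3 n" by (simp only: sum_constant of_nat_id)
  also have "card ?I = 9" by (simp add: card_cartesian_product)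
  finally show ?thesis .
qed

text \<open>In terms of norms, this is Parseval's identity for the Fourier matrix of order 3.\<close>

lemma size_form_fourier_map:
  assumes "fourier_map (y1, y2, y3) = (z1, z2, z3)"
  shows "size_form z1 + size_form z2 + size_form z3 =
    3 * (size_form y1 + size_form y2 + size_form y3) + 2"
  using assms
  by (cases y1; cases y2; cases y3)
     (auto simp: size_form_def power2_eq_square algebra_simps)

lemma inj_fourier_map: "inj fourier_map"
proof (rule injI)
  fix x y :: "(int \<times> int) \<times> (int \<times> int) \<times> (int \<times> int)"
  assume eq: "fourier_map x = fourier_map y"
  obtain a1 b1 a2 b2 a3 b3 where x: "x = ((a1, b1), (a2, b2), (a3, b3))"
    by (metis surj_pair)
  obtain c1 d1 c2 d2 c3 d3 where y: "y = ((c1, d1), (c2, d2), (c3, d3))"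
    by (metis surj_pair)
  have eqs: "a2 + a3 - a1 = c2 + c3 - c1" "b2 + b3 - b1 = d2 + d3 - d1"
    "b2 - a2 - b3 - a1 = d2 - c2 - d3 - c1" "a3 - a2 - b3 - b1 = c3 - c2 - d3 - d1"
    "b3 - b2 - a3 - a1 = d3 - d2 - c3 - c1" "a2 - b2 - a3 - b1 = c2 - d2 - c3 - d1"
    using eq by (simp_all add: x y)
  have "a1 = c1" "b1 = d1" "a2 = c2" "b2 = d2" "a3 = c3" "b3 = d3"
    using eqs by linarith+
  then show "x = y" by (simp add: x y)
qed

text \<open>For surjectivity, the inverse transform involves division by 3. It is integral because the
  sum of the sizes is congruent to 2 modulo 3: in residue class 0, the size of \<open>(a, b)\<close> is
  congruent to \<open>b\<close>, so that the \<open>b\<^sub>i\<close> sum to 2 modulo 3.\<close>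

lemma fourier_map_image:
  "fourier_map ` balanced_triples n = class_triples 0 0 0 (3 * n + 2)"
proof (intro set_eqI iffI)
  fix z assume "z \<in> fourier_map ` balanced_triples n"
  then obtain y where "y \<in> balanced_triples n" "z = fourier_map y"
    by (rule imageE)
  moreover obtain a1 b1 a2 b2 a3 b3 where "y = ((a1, b1), (a2, b2), (a3, b3))"
    by (metis surj_pair)
  ultimately have y: "((a1, b1), (a2, b2), (a3, b3)) \<in> balanced_triples n"
    and z: "z = fourier_map ((a1, b1), (a2, b2), (a3, b3))"
    by simp_all
  have bal: "3 dvd a2 + b2 + a3 + b3 - a1 - b1"
    and size: "size_form (a1, b1) + size_form (a2, b2) + size_form (a3, b3) = int n"
    using y by (simp_all add: mem_balanced_triples)
  obtain q where q: "a2 + b2 + a3 + b3 - a1 - b1 = 3 * q" using bal by (rule dvdE)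
  have "(a2 + a3 - a1) + (b2 + b3 - b1) = 3 * q"
    "(b2 - a2 - b3 - a1 - 1) + (a3 - a2 - b3 - b1 - 2) = 3 * (q - a2 - b3 - 1)"
    "(b3 - b2 - a3 - a1 - 1) + (a2 - b2 - a3 - b1 - 2) = 3 * (q - b2 - a3 - 1)"
    unfolding right_diff_distrib q[symmetric] by simp_all
  then have "3 dvd (a2 + a3 - a1) + (b2 + b3 - b1)"
    "3 dvd (b2 - a2 - b3 - a1 - 1) + (a3 - a2 - b3 - b1 - 2)"
    "3 dvd (b3 - b2 - a3 - a1 - 1) + (a2 - b2 - a3 - b1 - 2)"
    by (metis dvd_triv_left)+
  moreover have "size_form (a2 + a3 - a1, b2 + b3 - b1) +
      size_form (b2 - a2 - b3 - a1 - 1, a3 - a2 - b3 - b1 - 2) +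
      size_form (b3 - b2 - a3 - a1 - 1, a2 - b2 - a3 - b1 - 2) = int (3 * n + 2)"
    unfolding size_form_fourier_map[of "(a1, b1)" "(a2, b2)" "(a3, b3)", OF fourier_map.simps] size
    by simp
  ultimately show "z \<in> class_triples 0 0 0 (3 * n + 2)"
    by (simp only: z fourier_map.simps class_triples_def residue_class_def mod_eq_0_iff_dvd
        mem_Collect_eq prod.case simp_thms)
next
  fix z assume z_in: "z \<in> class_triples 0 0 0 (3 * n + 2)"
  obtain a1 b1 a2 b2 a3 b3 where z: "z = ((a1, b1), (a2, b2), (a3, b3))"
    by (metis surj_pair)
  have cls: "3 dvd a1 + b1" "3 dvd a2 + b2" "3 dvd a3 + b3"
    and size: "size_form (a1, b1) + size_form (a2, b2) + size_form (a3, b3) = 3 * int n + 2"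
    using z_in by (simp_all add: z class_triples_def residue_class_def mod_eq_0_iff_dvd)
  have size_mod: "3 dvd size_form (a, b) - b" if *: "3 dvd a + b" for a b
  proof -
    have "size_form (a, b) - b = (a + b) * (a + b) - 3 * (a * b)"
      by (simp add: size_form_def power2_eq_square algebra_simps)
    then show ?thesis using dvd_diff[OF dvd_mult2[OF *] dvd_triv_left] by (simp only:)
  qed
  have "b1 + b2 + b3 - 2 = 3 * int n -
      ((size_form (a1, b1) - b1) + (size_form (a2, b2) - b2) + (size_form (a3, b3) - b3))"
    using size by linarith
  then have "3 dvd b1 + b2 + b3 - 2"
    using dvd_diff[OF dvd_triv_left
        dvd_add[OF dvd_add[OF size_mod[OF cls(1)] size_mod[OF cls(2)]] size_mod[OF cls(3)]]]
    by (simp only:)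
  then obtain s where s: "b1 + b2 + b3 - 2 = 3 * s" by (rule dvdE)
  obtain c1 where c1: "a1 + b1 = 3 * c1" using cls(1) by (rule dvdE)
  obtain c2 where c2: "a2 + b2 = 3 * c2" using cls(2) by (rule dvdE)
  obtain c3 where c3: "a3 + b3 = 3 * c3" using cls(3) by (rule dvdE)
  \<comment> \<open>The inverse Fourier transform, with the divisions by 3 carried out.\<close>
  define x1 y1 x2 y2 x3 y3 where
    "x1 = s - c1 - c2 - c3" and "y1 = - s - 2" and
    "x2 = c1 - c3 + b3 - s - 1" and "y2 = c2 - c3 - b2 + s" and
    "x3 = c1 - c2 + b2 - s - 1" and "y3 = c3 - c2 - b3 + s"
  note witness = this
  have y: "fourier_map ((x1, y1), (x2, y2), (x3, y3)) = z"
  proof -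
    have "a1 = 3 * c1 - b1" "a2 = 3 * c2 - b2" "a3 = 3 * c3 - b3" "b1 = 3 * s + 2 - b2 - b3"
      using s c1 c2 c3 by linarith+
    then show ?thesis by (simp only: z witness fourier_map.simps) simp
  qed
  have "((x1, y1), (x2, y2), (x3, y3)) \<in> balanced_triples n"
    unfolding mem_balanced_triples
  proof
    have "x2 + y2 + x3 + y3 - x1 - y1 = a1 + b1"
      using y unfolding z fourier_map.simps prod.inject by linarith
    then show "3 dvd x2 + y2 + x3 + y3 - x1 - y1" using cls(1) by (simp only:)
    show "size_form (x1, y1) + size_form (x2, y2) + size_form (x3, y3) = int n"
      using size_form_fourier_map[OF y[unfolded z], unfolded size add_right_cancel mult_cancel_left]
      by simp
  qed
  then show "z \<in> fourier_map ` balanced_triples n"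
    using y by (rule rev_image_eqI[OF _ sym])
qed

lemma B3_triple: "B3 (3 * n + 2) = 9 * B3 n"
proof -
  have "B3 (3 * n + 2) = card (fourier_map ` balanced_triples n)"
    by (simp add: fourier_map_image class_triples_eq_core3_triples(2))
  also have "\<dots> = card (balanced_triples n)"
    using inj_fourier_map by (intro card_image) (auto intro: inj_on_subset)
  finally show ?thesis by (simp add: card_balanced_triples)
qed

theorem theorem2p3:
  fixes k n :: nat
  assumes "k \<ge> 1"
  shows "B3 (3 ^ k * n + 3 ^ k - 1) = 3 ^ (2 * k) * B3 n"
proof -
  have "B3 (3 ^ k * n + 3 ^ k - 1) = 9 ^ k * B3 n"
  proof (induction k)
    case (Suc k)
    have "0 < (3::nat) ^ k" by simp
    then have "3 ^ Suc k * n + 3 ^ Suc k - 1 = 3 * (3 ^ k * n + 3 ^ k - 1) + 2"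
      unfolding power_Suc by linarith
    then show ?case using B3_triple[of "3 ^ k * n + 3 ^ k - 1"] Suc by simp
  qed simp
  then show ?thesis by (simp add: power_mult)
qed

end
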